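(* Let $p_1,\dots,p_K$ be the training densities and $p^{(te)}$ the validation density on triples $(x,u,y)$ (observed features, unobserved features, label). Suppose that (1) there is $\alpha^*\in\mathcal A$ with $p^{(te)}(x,u)=p^{(\alpha^* )}(x,u)$ (equality of the marginals of $(x,u)$), and (2) there is a fixed conditional distribution $p(y\mid x,u)$ such that $p_i(y\mid x,u)=p(y\mid x,u)=p^{(te)}(y\mid x,u)$ for every $i\in\{1,\dots,K\}$. Then $$F^{(te)}(w)=F^{(\alpha^* )}(w)\qquad\text{for every } w\in\mathbb R^m .$$ Consequently, finding $w^*$ which solves $\min_{w\in\mathbb R^m}F^{(te)}(w)$ is equivalent to finding the mixture $\alpha^*$ and corresponding model $w^*(\alpha^* )$ which solve $\min_{\alpha\in\mathcal A}F^{(te)}(w^*(\alpha))$; that is, for $w^*\in\arg\min_w F^{(te)}(w)$, $$F^{(te)}(w^* )=F^{(\alpha^* )}(w^* )=F^{(\alpha^* )}(w^*(\alpha^* ))=\min_{\alpha\in\mathcal A}F^{(te)}(w^*(\alpha)).$$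
   Context: $\mathcal A=\{\alpha\in\mathbb R^K:\alpha_i\ge 0,\ \|\alpha\|_1=1\}$ is the mixture simplex, and $p^{(\alpha)}(x,u,y)=\sum_{i=1}^K\alpha_i p_i(x,u,y)$. An observed sample is $z=(x,y)\in\mathbb R^d\times\mathbb R$, the projection of $(x,u,y)$ with $u\in\mathbb R^{\hat d}$ unobserved. The loss of model $w\in\mathbb R^m$ on sample $z$ is $f(w;z)$; $F^{(\alpha)}(w)=\mathbb E_{z\sim p^{(\alpha)}}[f(w;z)]$ and $F^{(te)}(w)=\mathbb E_{z\sim p^{(te)}}[f(w;z)]$ (expectations assumed finite). For each $\alpha\in\mathcal A$, $w^*(\alpha)=\arg\min_{w\in\mathbb R^m}F^{(\alpha)}(w)$, which is assumed to exist and be unique (each $F^{(\alpha)}$ is strongly convex). *)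

theory Defs
  imports "HOL-Probability.Probability"
begin

text \<open>The index \<open>i \<in> {1, ..., K}\<close> is rendered by a finite type \<open>'k\<close>; the samples
  \<open>(x, u, y)\<close> live in \<open>(real ^ 'd) \<times> (real ^ 'h) \<times> real\<close>. All densities are with respect
  to Lebesgue measure.\<close>

definition mixture_simplex :: "(real ^ 'k) set" where
  "mixture_simplex = {\<alpha>. (\<forall>i. 0 \<le> \<alpha> $ i) \<and> (\<Sum>i\<in>UNIV. \<bar>\<alpha> $ i\<bar>) = 1}"

definition mixture :: "('k::finite \<Rightarrow> 'a \<Rightarrow> real) \<Rightarrow> real ^ 'k \<Rightarrow> 'a \<Rightarrow> real" where
  "mixture p \<alpha> s = (\<Sum>i\<in>UNIV. \<alpha> $ i * p i s)"

definition prob_density :: "('a::euclidean_space \<Rightarrow> real) \<Rightarrow> bool" where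
  "prob_density p \<longleftrightarrow>
     p \<in> borel_measurable borel \<and> (\<forall>s. 0 \<le> p s) \<and> (\<integral>\<^sup>+ s. ennreal (p s) \<partial>lborel) = 1"

definition marginal_xu ::
    "((real ^ 'd) \<times> (real ^ 'h) \<times> real \<Rightarrow> real) \<Rightarrow> (real ^ 'd) \<times> (real ^ 'h) \<Rightarrow> real" where
  "marginal_xu p = (\<lambda>(x, u). \<integral>y. p (x, u, y) \<partial>lborel)"

text \<open>Meaningful only where the marginal is positive; every use below is guarded accordingly.\<close>

definition cond_density_y ::
    "((real ^ 'd) \<times> (real ^ 'h) \<times> real \<Rightarrow> real) \<Rightarrow> (real ^ 'd) \<times> (real ^ 'h) \<Rightarrow> real \<Rightarrow> real" where
  "cond_density_y p = (\<lambda>(x, u) y. p (x, u, y) / marginal_xu p (x, u))"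

definition cond_distribution :: "((real ^ 'd) \<times> (real ^ 'h) \<Rightarrow> real \<Rightarrow> real) \<Rightarrow> bool" where
  "cond_distribution q \<longleftrightarrow>
     (\<lambda>(s, y). q s y) \<in> borel_measurable borel \<and> (\<forall>s. prob_density (q s))"

text \<open>\<open>p(y | x, u) = q(y | x, u)\<close>. Densities are determined only up to null sets and the
  conditional density only where the marginal of \<open>(x, u)\<close> is positive, so this is the
  equality that is independent of the chosen versions.\<close>

definition has_cond_y ::
    "((real ^ 'd) \<times> (real ^ 'h) \<times> real \<Rightarrow> real) \<Rightarrow> ((real ^ 'd) \<times> (real ^ 'h) \<Rightarrow> real \<Rightarrow> real) \<Rightarrow> bool" where
  "has_cond_y p q \<longleftrightarrow>
     (AE s in lborel. 0 < marginal_xu p s \<longrightarrow> (AE y in lborel. cond_density_y p s y = q s y))"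

definition observed_law ::
    "((real ^ 'd) \<times> (real ^ 'h) \<times> real \<Rightarrow> real) \<Rightarrow> ((real ^ 'd) \<times> real) measure" where
  "observed_law p =
     distr (density lborel (\<lambda>s. ennreal (p s))) borel (\<lambda>(x, u, y). (x, y))"

definition risk ::
    "(real ^ 'm \<Rightarrow> (real ^ 'd) \<times> real \<Rightarrow> real) \<Rightarrow> ((real ^ 'd) \<times> (real ^ 'h) \<times> real \<Rightarrow> real) \<Rightarrow>
      real ^ 'm \<Rightarrow> real" where
  "risk f p w = (\<integral>z. f w z \<partial>observed_law p)"

definition minimizer :: "('w \<Rightarrow> real) \<Rightarrow> 'w \<Rightarrow> bool" where
  "minimizer F w \<longleftrightarrow> is_arg_min F (\<lambda>_. True) w"

definition mixture_model ::
    "(real ^ 'm \<Rightarrow> (real ^ 'd) \<times> real \<Rightarrow> real) \<Rightarrow>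
      ('k::finite \<Rightarrow> (real ^ 'd) \<times> (real ^ 'h) \<times> real \<Rightarrow> real) \<Rightarrow> real ^ 'k \<Rightarrow> real ^ 'm" where
  "mixture_model f p \<alpha> = arg_min (risk f (mixture p \<alpha>)) (\<lambda>_. True)"

end

theory Submission
  imports Defs
begin

text \<open>Each density factors almost everywhere as its \<open>(x, u)\<close>-marginal times the common conditional
  density \<open>q\<close>. The factorization is linear in the density, so it passes to mixtures, and two
  densities with the same marginal and the same \<open>q\<close> agree almost everywhere. Hence the
  validation density and the \<open>\<alpha>\<^sup>*\<close>-mixture have the same observed law and the same risk; the
  equivalence of the two minimization problems is then a comparison of minimizers.\<close>

text \<open>Triples are nested as (x, (u, y)), whereas conditioning on (x, u) groups them as ((x,
  u), y). Fubini for null sets changes the grouping: split (x, u), merge u with y, then merge x with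
  (u, y).\<close>

lemma AE_lborel_assocI:
  fixes P :: "'a::euclidean_space \<times> 'b::euclidean_space \<times> 'c::euclidean_space \<Rightarrow> bool"
  assumes P: "{t. P t} \<in> sets borel"
    and ae: "AE s in lborel. AE y in lborel. P (fst s, snd s, y)"
  shows "AE t in lborel. P t"
proof -
  have [measurable]: "Measurable.pred (borel \<Otimes>\<^sub>M borel \<Otimes>\<^sub>M borel) P"
    using P by (simp add: pred_def borel_prod)
  \<comment> \<open>Splitting a product null set is free; it is the two merges below that call for
    measurability of \<open>P\<close>.\<close>
  have "AE x in lborel. AE u in lborel. AE y in lborel. P (x, u, y)"
    using lborel_pair.AE_pair [OF ae [folded lborel_prod]] by simp
  moreover have "(AE u in lborel. AE y in lborel. P (x, u, y))
      \<longleftrightarrow> (AE r in lborel \<Otimes>\<^sub>M lborel. P (x, fst r, snd r))" for x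
    by (rule lborel_pair.AE_pair_iff) measurable
  ultimately have "AE x in lborel. AE r in lborel. P (x, r)"
    by (simp only: lborel_prod prod.collapse)
  moreover have "{t \<in> space (lborel \<Otimes>\<^sub>M lborel). P t} \<in> sets (lborel \<Otimes>\<^sub>M lborel)"
    using P by (simp only: lborel_prod space_lborel sets_lborel space_borel UNIV_I simp_thms)
  ultimately have "AE t in lborel \<Otimes>\<^sub>M lborel. P t"
    by (intro lborel_pair.AE_pair_measure)
  then show ?thesis
    by (simp only: lborel_prod)
qed

text \<open>By Tonelli the slice integrals have total integral 1, so almost all of them are finite.
  This makes the Bochner integral in \<open>marginal_xu\<close> a genuine one: on a non-integrable
  slice it would take the default value 0.\<close>

lemma prob_density_AE_integrable:
  fixes p :: "'a::euclidean_space \<times> 'b::euclidean_space \<times> 'c::euclidean_space \<Rightarrow> real"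
  assumes "prob_density p"
  shows "AE s in lborel. integrable lborel (\<lambda>y. p (fst s, snd s, y))"
proof -
  have nn: "\<And>t. 0 \<le> p t" and one: "(\<integral>\<^sup>+ t. ennreal (p t) \<partial>lborel) = 1"
    and p: "p \<in> borel_measurable borel"
    using assms by (auto simp: prob_density_def)
  have [measurable]: "p \<in> borel_measurable (borel \<Otimes>\<^sub>M borel \<Otimes>\<^sub>M borel)"
    using p by (simp add: borel_prod)
  have "(\<integral>\<^sup>+ s. \<integral>\<^sup>+ y. ennreal (p (fst s, snd s, y)) \<partial>lborel \<partial>(lborel \<Otimes>\<^sub>M lborel))
      = (\<integral>\<^sup>+ x. \<integral>\<^sup>+ u. \<integral>\<^sup>+ y. ennreal (p (x, u, y)) \<partial>lborel \<partial>lborel \<partial>lborel)"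
    by (subst lborel.nn_integral_fst [symmetric]) simp_all
  also have "\<dots> = (\<integral>\<^sup>+ x. \<integral>\<^sup>+ r. ennreal (p (x, r)) \<partial>(lborel \<Otimes>\<^sub>M lborel) \<partial>lborel)"
    by (subst lborel.nn_integral_fst [symmetric]) simp_all
  also have "\<dots> = (\<integral>\<^sup>+ x. \<integral>\<^sup>+ r. ennreal (p (x, r)) \<partial>lborel \<partial>lborel)"
    by (simp only: lborel_prod)
  also have "\<dots> = (\<integral>\<^sup>+ t. ennreal (p t) \<partial>(lborel \<Otimes>\<^sub>M lborel))"
  proof (rule lborel.nn_integral_fst)
    have "(\<lambda>t. ennreal (p t)) \<in> borel_measurable lborel"
      using p by simp
    then show "(\<lambda>t. ennreal (p t)) \<in> borel_measurable (lborel \<Otimes>\<^sub>M lborel)"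
      by (simp only: lborel_prod)
  qed
  finally have "(\<integral>\<^sup>+ s. \<integral>\<^sup>+ y. ennreal (p (fst s, snd s, y)) \<partial>lborel \<partial>(lborel \<Otimes>\<^sub>M lborel)) \<noteq> \<infinity>"
    using one by (simp only: lborel_prod) simp
  then have "AE s in lborel \<Otimes>\<^sub>M lborel. (\<integral>\<^sup>+ y. ennreal (p (fst s, snd s, y)) \<partial>lborel) \<noteq> \<infinity>"
    by (intro nn_integral_PInf_AE) simp_all
  then have "AE s in lborel \<Otimes>\<^sub>M lborel. integrable lborel (\<lambda>y. p (fst s, snd s, y))"
  proof eventually_elim
    case (elim s)
    then show ?case
      using nn by (intro integrableI_nonneg) (auto simp: less_top)
  qed
  then show ?thesis
    by (simp only: lborel_prod)
qed

text \<open>Where the marginal is positive, clear the denominator of the conditional density. Where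
  it is zero, the slice is almost everywhere zero, so both sides vanish whatever \<open>q\<close> is
  there.\<close>

lemma has_cond_y_factorization:
  fixes p :: "(real ^ 'd) \<times> (real ^ 'h) \<times> real \<Rightarrow> real"
  assumes p: "prob_density p" and q: "has_cond_y p q"
  shows "AE s in lborel. AE y in lborel. p (fst s, snd s, y) = marginal_xu p s * q s y"
  using prob_density_AE_integrable [OF p] q [unfolded has_cond_y_def]
proof eventually_elim
  case (elim s)
  have nn: "\<And>t. 0 \<le> p t"
    using p by (auto simp: prob_density_def)
  have marg: "marginal_xu p s = (\<integral>y. p (fst s, snd s, y) \<partial>lborel)"
    by (simp add: marginal_xu_def case_prod_beta)
  then have "0 \<le> marginal_xu p s"
    using nn by simp
  then consider "marginal_xu p s = 0" | "0 < marginal_xu p s"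
    by linarith
  then show ?case
  proof cases
    case 1
    \<comment> \<open>Integrability of the slice, \<open>elim(1)\<close>, rules out that the
      integral is 0 merely by default.\<close>
    then have "AE y in lborel. p (fst s, snd s, y) = 0"
      using elim(1) nn marg by (simp add: integral_nonneg_eq_0_iff_AE)
    then show ?thesis
      using 1 by simp
  next
    case 2
    with elim(2) have "AE y in lborel. cond_density_y p s y = q s y"
      by simp
    then show ?thesis
      by eventually_elim (use 2 in \<open>auto simp: cond_density_y_def case_prod_beta field_simps\<close>)
  qed
qed

text \<open>Linearity of the integral applies at those (x, u) where all the component slices are
  integrable; the finitely many exceptional null sets are united.\<close>

lemma marginal_xu_mixture:
  fixes p :: "'k::finite \<Rightarrow> (real ^ 'd) \<times> (real ^ 'h) \<times> real \<Rightarrow> real"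
  assumes "\<And>i. prob_density (p i)"
  shows "AE s in lborel. marginal_xu (mixture p \<alpha>) s = (\<Sum>i\<in>UNIV. \<alpha> $ i * marginal_xu (p i) s)"
proof -
  have "AE s in lborel. \<forall>i. integrable lborel (\<lambda>y. p i (fst s, snd s, y))"
    using assms by (simp add: AE_all_countable prob_density_AE_integrable)
  then show ?thesis
    by eventually_elim (simp add: marginal_xu_def mixture_def case_prod_beta)
qed

text \<open>All components share \<open>q\<close>, so it factors out of the weighted sum and leaves
  the weighted sum of marginals, which is the marginal of the mixture.\<close>

lemma mixture_factorization:
  fixes p :: "'k::finite \<Rightarrow> (real ^ 'd) \<times> (real ^ 'h) \<times> real \<Rightarrow> real" and \<alpha> :: "real ^ 'k"
  assumes p: "\<And>i. prob_density (p i)" and q: "\<And>i. has_cond_y (p i) q"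
  shows "AE s in lborel. AE y in lborel.
    mixture p \<alpha> (fst s, snd s, y) = marginal_xu (mixture p \<alpha>) s * q s y"
proof -
  have "AE s in lborel. \<forall>i. AE y in lborel. p i (fst s, snd s, y) = marginal_xu (p i) s * q s y"
    using p q by (simp add: AE_all_countable has_cond_y_factorization)
  with marginal_xu_mixture [where p = p and \<alpha> = \<alpha>, OF p] show ?thesis
  proof eventually_elim
    case (elim s)
    from elim(2) have "AE y in lborel. \<forall>i. p i (fst s, snd s, y) = marginal_xu (p i) s * q s y"
      by (simp add: AE_all_countable)
    then show ?case
      by eventually_elim (simp add: elim(1) mixture_def sum_distrib_right mult.assoc)
  qed
qed

lemma borel_measurable_mixture:
  fixes p :: "'k::finite \<Rightarrow> 'a \<Rightarrow> real"
  assumes "\<And>i. p i \<in> borel_measurable M"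
  shows "mixture p \<alpha> \<in> borel_measurable M"
  using assms unfolding mixture_def [abs_def] by measurable

lemma observed_law_cong_AE:
  assumes "p \<in> borel_measurable borel" "p' \<in> borel_measurable borel"
    and "AE t in lborel. p t = p' t"
  shows "observed_law p = observed_law p'"
proof -
  have "density lborel (\<lambda>t. ennreal (p t)) = density lborel (\<lambda>t. ennreal (p' t))"
    using assms by (intro density_cong) auto
  then show ?thesis
    by (simp add: observed_law_def)
qed

lemma observed_law_eq_mixture:
  fixes p :: "'k::finite \<Rightarrow> (real ^ 'd) \<times> (real ^ 'h) \<times> real \<Rightarrow> real"
  assumes p: "\<And>i. prob_density (p i)" and p': "prob_density p'"
    and marg: "AE s in lborel. marginal_xu p' s = marginal_xu (mixture p \<alpha>) s"
    and q: "\<And>i. has_cond_y (p i) q" and q': "has_cond_y p' q"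
  shows "observed_law p' = observed_law (mixture p \<alpha>)"
proof (rule observed_law_cong_AE)
  show m': "p' \<in> borel_measurable borel"
    using p' by (simp add: prob_density_def)
  show m: "mixture p \<alpha> \<in> borel_measurable borel"
    using p by (intro borel_measurable_mixture) (simp add: prob_density_def)
  have "AE s in lborel. AE y in lborel. p' (fst s, snd s, y) = mixture p \<alpha> (fst s, snd s, y)"
    using marg mixture_factorization [where p = p and \<alpha> = \<alpha>, OF p q] has_cond_y_factorization [OF p' q']
  proof eventually_elim
    case (elim s)
    from elim(2,3) show ?case
      by eventually_elim (simp add: elim(1))
  qed
  \<comment> \<open>The agreement set is Borel, which lets the iterated statement become one about
    almost all triples.\<close>
  moreover have "{t. p' t = mixture p \<alpha> t} \<in> sets borel"
    using borel_measurable_eq [OF m' m] by (simp add: pred_def)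
  ultimately show "AE t in lborel. p' t = mixture p \<alpha> t"
    by (intro AE_lborel_assocI)
qed

lemma minimizer_iff: "minimizer F w \<longleftrightarrow> (\<forall>v. F w \<le> F v)" for F :: "'w \<Rightarrow> real"
  by (auto simp: minimizer_def is_arg_min_linorder)

theorem proposition1:
  fixes p :: "'k::finite \<Rightarrow> (real ^ 'd) \<times> (real ^ 'h) \<times> real \<Rightarrow> real"
    and p_te :: "(real ^ 'd) \<times> (real ^ 'h) \<times> real \<Rightarrow> real"
    and q :: "(real ^ 'd) \<times> (real ^ 'h) \<Rightarrow> real \<Rightarrow> real"
    and f :: "real ^ 'm \<Rightarrow> (real ^ 'd) \<times> real \<Rightarrow> real"
    and \<alpha>s :: "real ^ 'k"
  assumes dens: "\<And>i. prob_density (p i)"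
    and dens_te: "prob_density p_te"
    and finite_exp: "\<And>\<alpha> w. \<alpha> \<in> mixture_simplex \<Longrightarrow> integrable (observed_law (mixture p \<alpha>)) (f w)"
    and finite_exp_te: "\<And>w. integrable (observed_law p_te) (f w)"
    and unique_min: "\<And>\<alpha>. \<alpha> \<in> mixture_simplex \<Longrightarrow> \<exists>!w. minimizer (risk f (mixture p \<alpha>)) w"
    and \<alpha>s: "\<alpha>s \<in> mixture_simplex"
    and marginals: "AE s in lborel. marginal_xu p_te s = marginal_xu (mixture p \<alpha>s) s"
    and cond: "cond_distribution q"
    and cond_p: "\<And>i. has_cond_y (p i) q"
    and cond_te: "has_cond_y p_te q"
  shows "(\<forall>w. risk f p_te w = risk f (mixture p \<alpha>s) w)
    \<and> is_arg_min (\<lambda>\<alpha>. risk f p_te (mixture_model f p \<alpha>)) (\<lambda>\<alpha>. \<alpha> \<in> mixture_simplex) \<alpha>s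
    \<and> (\<forall>w. minimizer (risk f p_te) w \<longleftrightarrow>
          (\<exists>\<alpha>. is_arg_min (\<lambda>\<alpha>. risk f p_te (mixture_model f p \<alpha>)) (\<lambda>\<alpha>. \<alpha> \<in> mixture_simplex) \<alpha>
            \<and> w = mixture_model f p \<alpha>))
    \<and> (\<forall>w. minimizer (risk f p_te) w \<longrightarrow>
          risk f p_te w = risk f (mixture p \<alpha>s) w
          \<and> risk f (mixture p \<alpha>s) w = risk f (mixture p \<alpha>s) (mixture_model f p \<alpha>s)
          \<and> risk f (mixture p \<alpha>s) (mixture_model f p \<alpha>s)
              = (INF \<alpha>\<in>mixture_simplex. risk f p_te (mixture_model f p \<alpha>)))"
proof -
  let ?F = "risk f p_te" and ?w = "mixture_model f p"
  have law: "observed_law p_te = observed_law (mixture p \<alpha>s)"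
    using dens dens_te marginals cond_p cond_te by (rule observed_law_eq_mixture)
  \<comment> \<open>The loss does not see u, so \<open>risk\<close> depends on the density only
    through \<open>observed_law\<close>.\<close>
  have F: "?F = risk f (mixture p \<alpha>s)"
    by (simp add: fun_eq_iff risk_def law)
  have uniq: "\<exists>!w. minimizer ?F w"
    using unique_min [OF \<alpha>s] by (simp add: F)
  \<comment> \<open>\<open>arg_min\<close> is a Hilbert choice; existence of a minimizer guarantees
    that the chosen point is one.\<close>
  then have ws: "minimizer ?F (?w \<alpha>s)"
    unfolding F mixture_model_def minimizer_def arg_min_def by (rule ex1_implies_ex [THEN someI_ex])
  then have le: "?F (?w \<alpha>s) \<le> ?F v" for v
    by (simp add: minimizer_iff)
  have opt: "is_arg_min (\<lambda>\<alpha>. ?F (?w \<alpha>)) (\<lambda>\<alpha>. \<alpha> \<in> mixture_simplex) \<alpha>s"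
    using \<alpha>s le by (simp add: is_arg_min_linorder)
  have eq: "minimizer ?F w \<Longrightarrow> w = ?w \<alpha>s" for w
    using uniq ws by blast
  \<comment> \<open>An optimal mixture may differ from \<open>\<alpha>s\<close>, but its value is at
    most that of \<open>\<alpha>s\<close>, which is already the global minimum over all
    models.\<close>
  have conv: "minimizer ?F (?w \<alpha>)"
    if "is_arg_min (\<lambda>\<alpha>. ?F (?w \<alpha>)) (\<lambda>\<alpha>. \<alpha> \<in> mixture_simplex) \<alpha>" for \<alpha>
    using that \<alpha>s le unfolding minimizer_iff is_arg_min_linorder by (blast intro: order_trans)
  \<comment> \<open>The infimum is attained at \<open>\<alpha>s\<close>, so \<open>INF\<close> is a
    true minimum here.\<close>
  have "(INF \<alpha>\<in>mixture_simplex. ?F (?w \<alpha>)) = ?F (?w \<alpha>s)"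
    using \<alpha>s le by (intro cInf_eq_minimum) auto
  with opt eq conv show ?thesis
    unfolding F [symmetric] by (intro conjI allI impI iffI) auto
qed

end
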